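(* Let $x, \nu \in \mathbb{C}$ and define the infinite lower-triangular matrices $A(x,\nu) = (A_{n,k}(x,\nu))_{n,k \geqslant 1}$ and $B(x,\nu) = (B_{n,k}(x,\nu))_{n,k\geqslant 1}$ by $$ A_{n,k}(x,\nu) = (-1)^k\binom{n}{k}F(k-n,-n\nu;-n;x), \qquad B_{n,k}(x,\nu) = (-1)^k\binom{n}{k}F(k-n,k\nu;k;x) $$ for $1 \leqslant k \leqslant n$ (all entries with $k>n$ being zero). Then for any pair of complex sequences $(S_n)_{n \geqslant 1}$ and $(T_n)_{n \geqslant 1}$, the following inversion formula holds: $$ \Bigl( T_n = \sum_{k=1}^{n}A_{n,k}(x,\nu)S_k \ \text{ for all } n \geqslant 1 \Bigr) \Longleftrightarrow \Bigl( S_n=\sum_{k=1}^{n}B_{n,k}(x,\nu)T_k \ \text{ for all } n \geqslant 1 \Bigr). $$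
   Context: $(c)_m$ denotes the Pochhammer symbol, $(c)_0=1$ and $(c)_m = c(c+1)\cdots(c+m-1)$ for $m \geqslant 1$. $F(\alpha,\beta;\gamma;\cdot)$ is the Gauss hypergeometric function; for $1 \leqslant k \leqslant n$ the functions used here are the polynomials $$F(k-n,-n\nu;-n;x) = \sum_{m=0}^{n-k} \frac{(k-n)_m(-n\nu)_m}{(-n)_m \, m!} x^m, \qquad F(k-n,k\nu;k;x) = \sum_{m=0}^{n-k} \frac{(k-n)_m(k\nu)_m}{(k)_m \, m!} x^m,$$ where the denominators $(-n)_m = (-1)^m n!/(n-m)!$ do not vanish for $m \leqslant n-k<n$. *)

theory Defs
  imports "HOL-Analysis.FPS_Convergence"
begin

text \<open>
  The value at \<open>x\<close> of the Gauss series \<open>F(a, b; c; x)\<close>. Division by zero being zero, a term whose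
  denominator \<open>pochhammer c m\<close> vanishes contributes nothing. If \<open>a = -N\<close> for a natural number
  \<open>N\<close>, all terms with \<open>m > N\<close> are zero, so the series is a polynomial in \<open>x\<close>, also when
  \<open>c\<close> is an integer less than \<open>-N\<close>.
\<close>

definition gauss_F :: "complex \<Rightarrow> complex \<Rightarrow> complex \<Rightarrow> complex \<Rightarrow> complex" where
  "gauss_F a b c x = eval_fps (fps_hypergeo [a, b] [c] 1) x"

lemma gauss_F_terminating:
  "gauss_F (- of_nat N) b c x =
     (\<Sum>m=0..N. pochhammer (- of_nat N) m * pochhammer b m / (pochhammer c m * fact m) * x ^ m)"
proof -
  have "gauss_F (- of_nat N) b c x =
      (\<Sum>m. pochhammer (- of_nat N) m * pochhammer b m / (pochhammer c m * fact m) * x ^ m)"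
    by (simp add: gauss_F_def eval_fps_def)
  also have "\<dots> =
      (\<Sum>m=0..N. pochhammer (- of_nat N) m * pochhammer b m / (pochhammer c m * fact m) * x ^ m)"
    by (rule suminf_finite) (auto simp: pochhammer_of_nat_eq_0_iff)
  finally show ?thesis .
qed

definition A_mat :: "complex \<Rightarrow> complex \<Rightarrow> nat \<Rightarrow> nat \<Rightarrow> complex" where
  "A_mat x \<nu> n k =
     (if 1 \<le> k \<and> k \<le> n
      then (-1) ^ k * of_nat (n choose k) *
             gauss_F (of_nat k - of_nat n) (- of_nat n * \<nu>) (- of_nat n) x
      else 0)"

definition B_mat :: "complex \<Rightarrow> complex \<Rightarrow> nat \<Rightarrow> nat \<Rightarrow> complex" where
  "B_mat x \<nu> n k =
     (if 1 \<le> k \<and> k \<le> n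
      then (-1) ^ k * of_nat (n choose k) *
             gauss_F (of_nat k - of_nat n) (of_nat k * \<nu>) (of_nat k) x
      else 0)"

text \<open>The entries on and below the diagonal in terms of explicit polynomials in \<open>x\<close>; here none of
  the denominators vanishes.\<close>

lemma A_mat_explicit:
  assumes "1 \<le> k" "k \<le> n"
  shows "A_mat x \<nu> n k = (-1) ^ k * of_nat (n choose k) *
    (\<Sum>m=0..n-k. pochhammer (of_nat k - of_nat n) m * pochhammer (- of_nat n * \<nu>) m /
                 (pochhammer (- of_nat n) m * fact m) * x ^ m)"
  using assms gauss_F_terminating[of "n - k" "- of_nat n * \<nu>" "- of_nat n" x]
  by (simp add: A_mat_def of_nat_diff)

lemma B_mat_explicit:
  assumes "1 \<le> k" "k \<le> n"
  shows "B_mat x \<nu> n k = (-1) ^ k * of_nat (n choose k) *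
    (\<Sum>m=0..n-k. pochhammer (of_nat k - of_nat n) m * pochhammer (of_nat k * \<nu>) m /
                 (pochhammer (of_nat k) m * fact m) * x ^ m)"
  using assms gauss_F_terminating[of "n - k" "of_nat k * \<nu>" "of_nat k" x]
  by (simp add: B_mat_def of_nat_diff)

lemma denominators_nonzero:
  assumes "1 \<le> k" "k \<le> n" "m \<le> n - k"
  shows "pochhammer (- of_nat n :: complex) m \<noteq> 0" "pochhammer (of_nat k :: complex) m \<noteq> 0"
proof -
  show "pochhammer (- of_nat n :: complex) m \<noteq> 0"
    using assms by (simp add: pochhammer_of_nat_eq_0_iff)
  show "pochhammer (of_nat k :: complex) m \<noteq> 0"
    using assms by (simp add: pochhammer_of_nat pochhammer_pos)
qed

end

theory Submission
  imports Defs
begin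

text \<open>
  Both matrices factor through the binomial matrix \<open>C n k = (-1) ^ k * (n choose k)\<close>, which is its
  own inverse. Cancelling factorials in the hypergeometric terms, with \<open>(c)_m\<close> for
  \<open>pochhammer c m\<close>, turns the entries into
    \<^item> \<open>A n k = (\<Sum>m. (-n * \<nu>)_m / m! * x^m * (-1)^k * (n-m choose k))\<close>,
    \<^item> \<open>B n k = (\<Sum>m. (-1)^(k+m) * (n choose k+m) * (k+m) / k * (k * \<nu>)_m / m! * x^m)\<close>,

  which are matrix products summed over \<open>l = n - m\<close> and over \<open>l = k + m\<close>: \<open>A = P C\<close> and \<open>B = C Q\<close>,
  where \<open>P\<close> and \<open>Q\<close> carry the powers of \<open>x\<close>. It remains to see that \<open>P Q\<close> is the identity.

  With \<open>\<phi>(z) = (1 - x z) powr \<nu>\<close> one has \<open>P n l = [z^(n-l)] \<phi>^n\<close> and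
  \<open>Q l k = (l / k) [z^(l-k)] \<phi>^(-k)\<close>, hence for \<open>N = n - k > 0\<close>
  the entry of \<open>P Q\<close> is \<open>[z^N] (\<phi>^N - (z / N) (\<phi>^N)') = 0\<close>, as in Lagrange inversion.
  On coefficients this is two applications of the Chu--Vandermonde convolution, one for each
  summand of \<open>l / k = 1 + (l - k) / k\<close>; see \<open>binomial_series_convolution\<close> and
  \<open>lagrange_mats_inverse\<close>.

  A one-sided inverse suffices: for infinite lower triangular matrices a right inverse already
  gives the inversion formula in both directions (\<open>tri_inversion\<close>). Applied to \<open>P, Q\<close> and to
  \<open>C, C\<close>, it turns \<open>T = P (C S)\<close> into \<open>C S = Q T\<close> and then into \<open>S = C (Q T)\<close>.
\<close>

section \<open>Inversion of lower triangular matrices\<close>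

text \<open>
  Rows and columns are indexed from 1, and the summation ranges never reach an entry above the
  diagonal. So any function of two indices stands for a lower triangular matrix, whatever its
  values above the diagonal are.
\<close>

definition tri_apply :: "(nat \<Rightarrow> nat \<Rightarrow> 'a::comm_semiring_1) \<Rightarrow> (nat \<Rightarrow> 'a) \<Rightarrow> nat \<Rightarrow> 'a" where
  "tri_apply L S n = (\<Sum>k=1..n. L n k * S k)"

definition tri_mult ::
  "(nat \<Rightarrow> nat \<Rightarrow> 'a::comm_semiring_1) \<Rightarrow> (nat \<Rightarrow> nat \<Rightarrow> 'a) \<Rightarrow> nat \<Rightarrow> nat \<Rightarrow> 'a" where
  "tri_mult L M n k = (\<Sum>l=k..n. L n l * M l k)"

lemma tri_apply_tri_apply: "tri_apply L (tri_apply M S) n = tri_apply (tri_mult L M) S n"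
proof -
  have "tri_apply L (tri_apply M S) n = (\<Sum>l=1..n. \<Sum>k=1..l. L n l * M l k * S k)"
    by (simp add: tri_apply_def sum_distrib_left mult.assoc)
  also have "\<dots> = (\<Sum>k=1..n. \<Sum>l=k..n. L n l * M l k * S k)"
    unfolding sum.Sigma[OF finite_atLeastAtMost ballI[OF finite_atLeastAtMost]]
    by (rule sum.reindex_bij_witness[of _ "\<lambda>(k, l). (l, k)" "\<lambda>(l, k). (k, l)"]) auto
  also have "\<dots> = tri_apply (tri_mult L M) S n"
    by (simp add: tri_apply_def tri_mult_def sum_distrib_right)
  finally show ?thesis .
qed

lemma tri_apply_cong:
  assumes "\<And>k. 1 \<le> k \<Longrightarrow> k \<le> n \<Longrightarrow> L n k = M n k" "\<And>k. 1 \<le> k \<Longrightarrow> k \<le> n \<Longrightarrow> S k = T k"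
  shows "tri_apply L S n = tri_apply M T n"
  using assms by (auto simp: tri_apply_def intro: sum.cong)

text \<open>Forward substitution: a nonvanishing diagonal determines the entries one after another.\<close>

lemma tri_apply_inj:
  fixes L :: "nat \<Rightarrow> nat \<Rightarrow> 'a::field"
  assumes diag: "\<And>n. n \<ge> 1 \<Longrightarrow> L n n \<noteq> 0"
    and eq: "\<And>n. n \<ge> 1 \<Longrightarrow> tri_apply L S n = tri_apply L T n"
    and "n \<ge> 1"
  shows "S n = T n"
  using \<open>n \<ge> 1\<close>
proof (induction n rule: less_induct)
  case (less n)
  have split: "tri_apply L U n = L n n * U n + (\<Sum>k\<in>{1..<n}. L n k * U k)" for U
    using less.prems by (simp add: tri_apply_def sum.last_plus)
  have "(\<Sum>k\<in>{1..<n}. L n k * S k) = (\<Sum>k\<in>{1..<n}. L n k * T k)"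
    using less.IH by (intro sum.cong) auto
  with eq[OF less.prems] have "L n n * S n = L n n * T n"
    by (simp add: split)
  with diag[OF less.prems] show ?case by simp
qed

text \<open>
  The direction from right to left is \<open>L (M T) = T\<close>. Conversely, if \<open>T = L S\<close> then \<open>L\<close> sends
  both \<open>S\<close> and \<open>M T\<close> to \<open>T\<close>, and \<open>L\<close> is injective because \<open>L n n * M n n = 1\<close>.
\<close>

lemma tri_inversion:
  fixes L M :: "nat \<Rightarrow> nat \<Rightarrow> 'a::field"
  assumes inv: "\<And>n k. 1 \<le> k \<Longrightarrow> k \<le> n \<Longrightarrow> tri_mult L M n k = of_bool (n = k)"
  shows "(\<forall>n\<ge>1. T n = tri_apply L S n) \<longleftrightarrow> (\<forall>n\<ge>1. S n = tri_apply M T n)"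
proof -
  have LM: "tri_apply L (tri_apply M T) n = T n" if "n \<ge> 1" for n
  proof -
    have "tri_apply L (tri_apply M T) n = tri_apply (\<lambda>n k. of_bool (n = k)) T n"
      by (subst tri_apply_tri_apply) (rule tri_apply_cong, simp_all add: inv)
    also have "\<dots> = (\<Sum>k=1..n. if n = k then T k else 0)"
      unfolding tri_apply_def by (intro sum.cong) auto
    also have "\<dots> = T n"
      using that by simp
    finally show ?thesis .
  qed
  have diag: "L n n \<noteq> 0" if "n \<ge> 1" for n
    using inv[of n n] that by (auto simp: tri_mult_def)
  show ?thesis
  proof (intro iffI allI impI)
    fix n :: nat assume T: "\<forall>n\<ge>1. T n = tri_apply L S n" and n: "n \<ge> 1"
    show "S n = tri_apply M T n"
    proof (rule tri_apply_inj[where L = L])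
      show "tri_apply L S m = tri_apply L (tri_apply M T) m" if "m \<ge> 1" for m
        using T LM that by simp
    qed (use diag n in auto)
  next
    fix n :: nat assume S: "\<forall>n\<ge>1. S n = tri_apply M T n" and n: "n \<ge> 1"
    have "tri_apply L S n = tri_apply L (tri_apply M T) n"
      using S by (intro tri_apply_cong) auto
    then show "T n = tri_apply L S n" using LM n by simp
  qed
qed

section \<open>The binomial involution\<close>

definition binom_mat :: "nat \<Rightarrow> nat \<Rightarrow> 'a::comm_ring_1" where
  "binom_mat n k = (-1) ^ k * of_nat (n choose k)"

text \<open>
  Since \<open>(n choose l) * (l choose k) = (n choose k) * (n - k choose l - k)\<close>, the entry is
  \<open>(n choose k) * (1 - 1) ^ (n - k)\<close>.
\<close>

lemma binom_mat_involution:
  assumes "k \<le> n"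
  shows "tri_mult binom_mat binom_mat n k = (of_bool (n = k) :: 'a::idom)"
proof -
  have "tri_mult binom_mat binom_mat n k =
      (\<Sum>l=k..n. (-1) ^ (l - k) * of_nat (n choose k) * of_nat ((n - k) choose (l - k)) :: 'a)"
    unfolding tri_mult_def
  proof (intro sum.cong refl)
    fix l assume l: "l \<in> {k..n}"
    then have ch: "(of_nat (n choose l) * of_nat (l choose k) :: 'a) =
        of_nat (n choose k) * of_nat ((n - k) choose (l - k))"
      using choose_mult[of k l n] by (simp flip: of_nat_mult)
    have "even (l + k) \<longleftrightarrow> even (l - k)" using l by auto
    then have sg: "(-1 :: 'a) ^ l * (-1) ^ k = (-1) ^ (l - k)"
      by (simp add: minus_one_power_iff flip: power_add)
    have "binom_mat n l * binom_mat l k =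
        ((-1) ^ l * (-1) ^ k) * (of_nat (n choose l) * of_nat (l choose k) :: 'a)"
      by (simp add: binom_mat_def mult_ac)
    then show "binom_mat n l * binom_mat l k =
        ((-1) ^ (l - k) * of_nat (n choose k) * of_nat ((n - k) choose (l - k)) :: 'a)"
      by (simp only: ch sg mult.assoc)
  qed
  also have "\<dots> = of_nat (n choose k) * (\<Sum>i\<le>n-k. (-1) ^ i * of_nat ((n - k) choose i))"
    unfolding sum_distrib_left
    by (rule sum.reindex_bij_witness[of _ "\<lambda>i. i + k" "\<lambda>l. l - k"]) (use assms in auto)
  also have "\<dots> = of_bool (n = k)"
    using assms choose_alternating_sum[of "n - k", where ?'a = 'a] by (cases "n = k") auto
  finally show ?thesis .
qed

section \<open>The Lagrange pair\<close>

text \<open>This is the coefficient of \<open>z ^ m\<close> in \<open>(1 - z) powr (-a)\<close>.\<close>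

definition binomial_series_coeff :: "complex \<Rightarrow> nat \<Rightarrow> complex" where
  "binomial_series_coeff a m = pochhammer a m / fact m"

text \<open>The Chu--Vandermonde identity, i.e. multiplication of two binomial series.\<close>

lemma binomial_series_convolution:
  "(\<Sum>i\<le>N. binomial_series_coeff a i * binomial_series_coeff b (N - i)) =
     binomial_series_coeff (a + b) N"
proof -
  have "binomial_series_coeff (a + b) N =
      (\<Sum>i\<le>N. of_nat (N choose i) * pochhammer a i * pochhammer b (N - i) / fact N)"
    by (simp add: binomial_series_coeff_def pochhammer_binomial_sum sum_divide_distrib)
  also have "\<dots> = (\<Sum>i\<le>N. binomial_series_coeff a i * binomial_series_coeff b (N - i))"
    by (intro sum.cong) (auto simp: binomial_series_coeff_def binomial_fact)
  finally show ?thesis by simp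
qed

text \<open>The derivative of \<open>(1 - z) powr (-a)\<close> is \<open>a * (1 - z) powr (-(a + 1))\<close>.\<close>

lemma binomial_series_coeff_Suc:
  "of_nat (Suc i) * binomial_series_coeff a (Suc i) = a * binomial_series_coeff (a + 1) i"
  by (simp add: binomial_series_coeff_def pochhammer_rec field_simps del: of_nat_Suc)

lemma binomial_series_deriv_convolution:
  "(\<Sum>i\<le>Suc N. of_nat i * binomial_series_coeff a i * binomial_series_coeff b (Suc N - i)) =
     a * binomial_series_coeff (a + b + 1) N"
proof -
  have "(\<Sum>i\<le>Suc N. of_nat i * binomial_series_coeff a i * binomial_series_coeff b (Suc N - i)) =
      (\<Sum>i\<le>N. of_nat (Suc i) * binomial_series_coeff a (Suc i) * binomial_series_coeff b (N - i))"
    by (subst sum.atMost_Suc_shift) simp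
  also have "\<dots> = a * (\<Sum>i\<le>N. binomial_series_coeff (a + 1) i * binomial_series_coeff b (N - i))"
    by (simp only: binomial_series_coeff_Suc sum_distrib_left mult.assoc)
  finally show ?thesis by (simp only: binomial_series_convolution add_ac)
qed

definition P_mat :: "complex \<Rightarrow> complex \<Rightarrow> nat \<Rightarrow> nat \<Rightarrow> complex" where
  "P_mat x \<nu> n l = binomial_series_coeff (- of_nat n * \<nu>) (n - l) * x ^ (n - l)"

definition Q_mat :: "complex \<Rightarrow> complex \<Rightarrow> nat \<Rightarrow> nat \<Rightarrow> complex" where
  "Q_mat x \<nu> l k = of_nat l / of_nat k * binomial_series_coeff (of_nat k * \<nu>) (l - k) * x ^ (l - k)"

text \<open>
  For \<open>n > k\<close> put \<open>a = k * \<nu>\<close>, \<open>b = -n * \<nu>\<close> and \<open>N = n - k\<close>, so that \<open>a + b = -N * \<nu>\<close>. Splitting \<open>l / k\<close> as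
  \<open>1 + (l - k) / k\<close>, the two convolutions give the coefficient of index \<open>N\<close> for \<open>a + b\<close> plus
  \<open>\<nu>\<close> times the coefficient of index \<open>N - 1\<close> for \<open>a + b + 1\<close>. By the derivative rule the former
  is \<open>(a + b) / N = -\<nu>\<close> times the latter, and the two cancel.
\<close>

lemma lagrange_mats_inverse:
  assumes "1 \<le> k" "k \<le> n"
  shows "tri_mult (P_mat x \<nu>) (Q_mat x \<nu>) n k = of_bool (n = k)"
proof -
  define N where "N = n - k"
  define a where "a = of_nat k * \<nu>"
  define b where "b = - of_nat n * \<nu>"
  have n: "n = k + N" using assms by (simp add: N_def)
  have ab: "a + b = - of_nat N * \<nu>" by (simp add: a_def b_def n algebra_simps)
  have k0: "(of_nat k :: complex) \<noteq> 0" using assms by simp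
  let ?f = "\<lambda>i. binomial_series_coeff a i * binomial_series_coeff b (N - i)"
  have "tri_mult (P_mat x \<nu>) (Q_mat x \<nu>) n k =
      (\<Sum>i\<le>N. P_mat x \<nu> n (k + i) * Q_mat x \<nu> (k + i) k)"
    unfolding tri_mult_def
    by (rule sum.reindex_bij_witness[of _ "\<lambda>i. k + i" "\<lambda>l. l - k"]) (auto simp: n)
  also have "\<dots> = (\<Sum>i\<le>N. x ^ N * (?f i + of_nat i * ?f i / of_nat k))"
  proof (intro sum.cong refl)
    fix i assume "i \<in> {..N}"
    then have x_pow: "x ^ (N - i) * x ^ i = x ^ N" by (simp flip: power_add)
    have split: "of_nat (k + i) / of_nat k * ?f i = ?f i + of_nat i * ?f i / of_nat k"
      using k0 by (simp add: field_simps)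
    have "P_mat x \<nu> n (k + i) * Q_mat x \<nu> (k + i) k =
        (x ^ (N - i) * x ^ i) * (of_nat (k + i) / of_nat k * ?f i)"
      by (simp add: P_mat_def Q_mat_def n a_def b_def)
    then show "P_mat x \<nu> n (k + i) * Q_mat x \<nu> (k + i) k =
        x ^ N * (?f i + of_nat i * ?f i / of_nat k)"
      unfolding x_pow split .
  qed
  also have "\<dots> = x ^ N * ((\<Sum>i\<le>N. ?f i) + (\<Sum>i\<le>N. of_nat i * ?f i) / of_nat k)"
    by (simp add: sum.distrib sum_divide_distrib flip: sum_distrib_left)
  also have "\<dots> = of_bool (N = 0)"
  proof (cases N)
    case 0
    then show ?thesis by (simp add: binomial_series_coeff_def)
  next
    case (Suc M)
    have "of_nat (Suc M) * binomial_series_coeff (a + b) (Suc M) =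
        of_nat (Suc M) * (- \<nu> * binomial_series_coeff (a + b + 1) M)"
      by (simp only: binomial_series_coeff_Suc) (simp add: ab Suc algebra_simps)
    then have "binomial_series_coeff (a + b) (Suc M) = - \<nu> * binomial_series_coeff (a + b + 1) M"
      by (simp only: mult_cancel_left of_nat_eq_0_iff) simp
    moreover have "(\<Sum>i\<le>N. of_nat i * ?f i) / of_nat k = \<nu> * binomial_series_coeff (a + b + 1) M"
      using binomial_series_deriv_convolution[where N = M and a = a and b = b] k0
      by (simp add: Suc mult.assoc) (simp add: a_def)
    moreover have "(\<Sum>i\<le>N. ?f i) = binomial_series_coeff (a + b) (Suc M)"
      by (simp only: binomial_series_convolution Suc)
    ultimately show ?thesis by (simp add: Suc)
  qed
  finally show ?thesis by (simp add: n)
qed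

section \<open>Factorization of the hypergeometric matrices\<close>

lemma pochhammer_minus_of_nat:
  assumes "m \<le> N"
  shows "pochhammer (- of_nat N) m = (-1) ^ m * (fact N / fact (N - m) :: 'a::field_char_0)"
proof -
  have "fact N = fact m * fact (N - m) * (of_nat (N choose m) :: 'a)"
    using binomial_fact_lemma[OF assms] by (metis of_nat_fact of_nat_mult)
  then show ?thesis
    using pochhammer_minus[of "of_nat N :: 'a" m] gbinomial_pochhammer[of "of_nat N :: 'a" m]
    by (simp add: binomial_gbinomial field_simps)
qed

lemma pochhammer_of_nat_fact:
  assumes "1 \<le> k"
  shows "pochhammer (of_nat k) m = (fact (k + m - 1) / fact (k - 1) :: 'a::field_char_0)"
proof -
  obtain j where "k = Suc j" using assms by (cases k) auto
  moreover have "fact (j + m) = fact j * (pochhammer (of_nat (Suc j)) m :: 'a)"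
    using pochhammer_product'[of "1 :: 'a" j m] by (simp add: pochhammer_fact add.commute)
  ultimately show ?thesis by simp
qed

lemma pochhammer_of_nat_diff:
  assumes "m \<le> n - k" "k \<le> n"
  shows "pochhammer (of_nat k - of_nat n) m =
    ((-1) ^ m * (fact (n - k) / fact (n - k - m)) :: 'a::field_char_0)"
proof -
  have kn: "(of_nat k - of_nat n :: 'a) = - of_nat (n - k)"
    using assms by (simp add: of_nat_diff)
  show ?thesis unfolding kn by (rule pochhammer_minus_of_nat[OF assms(1)])
qed

text \<open>
  These two evaluations let \<open>m\<close> be absorbed into the binomial coefficient: into its upper
  index for \<open>A\<close>, into its lower index for \<open>B\<close>. In the second, both sides equal
  \<open>(-1)^m * n! / (k * (k + m - 1)! * (n - k - m)!)\<close>.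
\<close>

lemma choose_mult_pochhammer_ratio_upper:
  assumes "m \<le> n - k" "k \<le> n"
  shows "of_nat (n choose k) * pochhammer (of_nat k - of_nat n) m / pochhammer (- of_nat n) m =
    (of_nat ((n - m) choose k) :: 'a::field_char_0)"
proof -
  have le: "m \<le> n" "k \<le> n - m" and eq: "n - m - k = n - k - m" using assms by auto
  show ?thesis
    unfolding pochhammer_of_nat_diff[OF assms] pochhammer_minus_of_nat[OF le(1)]
      binomial_fact[OF assms(2)] binomial_fact[OF le(2)] eq
    by simp
qed

lemma choose_mult_pochhammer_ratio_lower:
  assumes "m \<le> n - k" "1 \<le> k" "k \<le> n"
  shows "of_nat (n choose k) * pochhammer (of_nat k - of_nat n) m / pochhammer (of_nat k) m =
    ((-1) ^ m * of_nat (n choose (k + m)) * (of_nat (k + m) / of_nat k) :: 'a::field_char_0)"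
proof -
  have le: "k + m \<le> n" and eq: "n - (k + m) = n - k - m" using assms by auto
  have fact_pred: "fact k = of_nat k * (fact (k - 1) :: 'a)"
      "fact (k + m) = of_nat (k + m) * (fact (k + m - 1) :: 'a)"
    using assms by (simp_all add: fact_reduce)
  have nz: "of_nat k \<noteq> (0 :: 'a)" "of_nat (k + m) \<noteq> (0 :: 'a)"
    using assms by (simp_all del: of_nat_add)
  show ?thesis
    unfolding pochhammer_of_nat_diff[OF assms(1,3)] pochhammer_of_nat_fact[OF assms(2)]
      binomial_fact[OF assms(3)] binomial_fact[OF le] eq fact_pred
    using nz by (simp add: mult_ac del: of_nat_add)
qed

lemma A_mat_factorization:
  assumes "1 \<le> k" "k \<le> n"
  shows "A_mat x \<nu> n k = tri_mult (P_mat x \<nu>) binom_mat n k"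
proof -
  have "A_mat x \<nu> n k = (\<Sum>m=0..n-k. (-1) ^ k *
      (of_nat (n choose k) * pochhammer (of_nat k - of_nat n) m / pochhammer (- of_nat n) m) *
      binomial_series_coeff (- of_nat n * \<nu>) m * x ^ m)"
    unfolding A_mat_explicit[OF assms] sum_distrib_left
    by (simp add: binomial_series_coeff_def mult_ac)
  also have "\<dots> = (\<Sum>m=0..n-k. P_mat x \<nu> n (n - m) * binom_mat (n - m) k)"
    using assms
    by (intro sum.cong)
      (auto simp: choose_mult_pochhammer_ratio_upper P_mat_def binom_mat_def)
  also have "\<dots> = tri_mult (P_mat x \<nu>) binom_mat n k"
    unfolding tri_mult_def
    by (rule sum.reindex_bij_witness[of _ "\<lambda>l. n - l" "\<lambda>m. n - m"]) (use assms in auto)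
  finally show ?thesis .
qed

lemma B_mat_factorization:
  assumes "1 \<le> k" "k \<le> n"
  shows "B_mat x \<nu> n k = tri_mult binom_mat (Q_mat x \<nu>) n k"
proof -
  have "B_mat x \<nu> n k = (\<Sum>m=0..n-k. (-1) ^ k *
      (of_nat (n choose k) * pochhammer (of_nat k - of_nat n) m / pochhammer (of_nat k) m) *
      binomial_series_coeff (of_nat k * \<nu>) m * x ^ m)"
    unfolding B_mat_explicit[OF assms] sum_distrib_left
    by (simp add: binomial_series_coeff_def mult_ac)
  also have "\<dots> = (\<Sum>m=0..n-k. binom_mat n (k + m) * Q_mat x \<nu> (k + m) k)"
    using assms
    by (intro sum.cong refl, subst choose_mult_pochhammer_ratio_lower)
      (auto simp: Q_mat_def binom_mat_def power_add)
  also have "\<dots> = tri_mult binom_mat (Q_mat x \<nu>) n k"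
    unfolding tri_mult_def
    by (rule sum.reindex_bij_witness[of _ "\<lambda>l. l - k" "\<lambda>m. k + m"]) (use assms in auto)
  finally show ?thesis .
qed

section \<open>The inversion formula\<close>

theorem theorem2p1:
  fixes x \<nu> :: complex and S T :: "nat \<Rightarrow> complex"
  shows "(\<forall>n\<ge>1. T n = (\<Sum>k=1..n. A_mat x \<nu> n k * S k)) \<longleftrightarrow>
         (\<forall>n\<ge>1. S n = (\<Sum>k=1..n. B_mat x \<nu> n k * T k))"
proof -
  have A: "(\<Sum>k=1..n. A_mat x \<nu> n k * S k) = tri_apply (P_mat x \<nu>) (tri_apply binom_mat S) n" for n
    unfolding tri_apply_tri_apply by (simp add: tri_apply_def A_mat_factorization)
  have B: "(\<Sum>k=1..n. B_mat x \<nu> n k * T k) = tri_apply binom_mat (tri_apply (Q_mat x \<nu>) T) n" for n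
    unfolding tri_apply_tri_apply by (simp add: tri_apply_def B_mat_factorization)
  have "(\<forall>n\<ge>1. T n = tri_apply (P_mat x \<nu>) (tri_apply binom_mat S) n) \<longleftrightarrow>
      (\<forall>n\<ge>1. tri_apply binom_mat S n = tri_apply (Q_mat x \<nu>) T n)"
    by (rule tri_inversion) (rule lagrange_mats_inverse)
  also have "\<dots> \<longleftrightarrow> (\<forall>n\<ge>1. tri_apply (Q_mat x \<nu>) T n = tri_apply binom_mat S n)"
    by (simp add: eq_commute)
  also have "\<dots> \<longleftrightarrow> (\<forall>n\<ge>1. S n = tri_apply binom_mat (tri_apply (Q_mat x \<nu>) T) n)"
    by (rule tri_inversion) (rule binom_mat_involution)
  finally show ?thesis unfolding A B .
qed

end
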